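(* Let $L$ be a complete lattice equipped with an antitone unary operation $\neg$ with $\neg1=0$, a completely multiplicative unary operation $\Box$, and a completely additive unary operation $\Diamond$. Define $X=\{(a,b)\mid a,b\in L,\ \neg a\leq b\}$, and for $x=(a,b)\in X$ write $x_0=a$, $x_1=b$. Define $x\vartriangleleft y$ iff $y_0\not\leq x_1$; $xRy$ iff for all $a\in L$, $x_0\leq\Box a$ implies $y_0\leq a$; $xQy$ iff for all $a\in L$, $\Diamond a\leq x_1$ implies $a\leq y_1$. Then $(X,\vartriangleleft,R,Q)$ is an additive modal frame, and $(L,\neg,\Box,\Diamond)$ is isomorphic to $(\mathfrak{L}(X,\vartriangleleft),\neg_\vartriangleleft,\Box_R,\Diamond_Q)$.
   Context: A modal frame is a tuple $(X,\vartriangleleft,R,Q)$ with $X$ nonempty and $\vartriangleleft,R,Q$ binary relations on $X$ such that for all $x,y,z$: if $xRy$ and $z\vartriangleleft y$, then there is $x'\vartriangleleft x$ such that for all $x''$ with $x'\vartriangleleft x''$ there is $y''$ with $x''Ry''$ and $z\vartriangleleft y''$. It is additive if for all $x,y,z$: if $xQy$ and $y\vartriangleleft z$, then there is $x'$ with $x\vartriangleleft x'$ such that for all $x''\vartriangleleft x'$ there is $y''$ with $x''Qy''$ and $y''\vartriangleleft z$. ($u\vartriangleright v$ means $v\vartriangleleft u$.) $c_\vartriangleleft(A)=\{x\mid \forall y\vartriangleleft x\ \exists z\vartriangleright y: z\in A\}$; $\mathfrak{L}(X,\vartriangleleft)$ is the complete lattice of $c_\vartriangleleft$-fixpoints (meet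 = intersection, join = $c_\vartriangleleft$ of union). $\neg_\vartriangleleft A=\{x\mid \forall y\vartriangleleft x,\ y\notin A\}$; $\Box_RA=\{x\mid \forall y(xRy\Rightarrow y\in A)\}$; $\Diamond_QA=\{x\mid \forall x'\vartriangleleft x\ \exists y'\,(x'Qy')\ \exists y\vartriangleright y': y\in A\}$. Completely multiplicative: $\Box\bigwedge S=\bigwedge\{\Box a\mid a\in S\}$ for all $S\subseteq L$; completely additive: $\Diamond\bigvee S=\bigvee\{\Diamond a\mid a\in S\}$ for all $S\subseteq L$. *)

theory Defs
  imports Main
begin

section \<open>Modal frames\<close>

text \<open>
  A frame is given by a carrier set \<open>X\<close> and three relations on \<open>X\<close>, each a set of pairs;
  \<open>(u, v) \<in> lt\<close> stands for \<open>u \<lhd> v\<close>.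
\<close>

locale modal_frame =
  fixes X :: "'x set" and lt R Q :: "'x rel"
  assumes nonempty: "X \<noteq> {}"
    and lt_on: "lt \<subseteq> X \<times> X"
    and R_on: "R \<subseteq> X \<times> X"
    and Q_on: "Q \<subseteq> X \<times> X"
    and R_condition:
      "\<forall>x\<in>X. \<forall>y\<in>X. \<forall>z\<in>X. (x, y) \<in> R \<and> (z, y) \<in> lt \<longrightarrow>
         (\<exists>x'\<in>X. (x', x) \<in> lt \<and>
           (\<forall>x''\<in>X. (x', x'') \<in> lt \<longrightarrow> (\<exists>y''\<in>X. (x'', y'') \<in> R \<and> (z, y'') \<in> lt)))"

locale additive_modal_frame = modal_frame +
  assumes Q_condition:
      "\<forall>x\<in>X. \<forall>y\<in>X. \<forall>z\<in>X. (x, y) \<in> Q \<and> (y, z) \<in> lt \<longrightarrow>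
         (\<exists>x'\<in>X. (x, x') \<in> lt \<and>
           (\<forall>x''\<in>X. (x'', x') \<in> lt \<longrightarrow> (\<exists>y''\<in>X. (x'', y'') \<in> Q \<and> (y'', z) \<in> lt)))"

definition frame_closure :: "'x set \<Rightarrow> 'x rel \<Rightarrow> 'x set \<Rightarrow> 'x set" where
  "frame_closure X lt A = {x \<in> X. \<forall>y\<in>X. (y, x) \<in> lt \<longrightarrow> (\<exists>z\<in>X. (y, z) \<in> lt \<and> z \<in> A)}"

definition closure_fixpoints :: "'x set \<Rightarrow> 'x rel \<Rightarrow> 'x set set" where
  "closure_fixpoints X lt = {A. A \<subseteq> X \<and> frame_closure X lt A = A}"

definition frame_neg :: "'x set \<Rightarrow> 'x rel \<Rightarrow> 'x set \<Rightarrow> 'x set" where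
  "frame_neg X lt A = {x \<in> X. \<forall>y\<in>X. (y, x) \<in> lt \<longrightarrow> y \<notin> A}"

definition frame_box :: "'x set \<Rightarrow> 'x rel \<Rightarrow> 'x set \<Rightarrow> 'x set" where
  "frame_box X R A = {x \<in> X. \<forall>y\<in>X. (x, y) \<in> R \<longrightarrow> y \<in> A}"

definition frame_diamond :: "'x set \<Rightarrow> 'x rel \<Rightarrow> 'x rel \<Rightarrow> 'x set \<Rightarrow> 'x set" where
  "frame_diamond X lt Q A =
     {x \<in> X. \<forall>x'\<in>X. (x', x) \<in> lt \<longrightarrow>
        (\<exists>y'\<in>X. (x', y') \<in> Q \<and> (\<exists>y\<in>X. (y', y) \<in> lt \<and> y \<in> A))}"


section \<open>Complete lattices with three unary operations\<close>

record 'a modal_lattice =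
  carrier :: "'a set"
  le :: "'a \<Rightarrow> 'a \<Rightarrow> bool"
  Meet :: "'a set \<Rightarrow> 'a"
  Join :: "'a set \<Rightarrow> 'a"
  neg :: "'a \<Rightarrow> 'a"
  box :: "'a \<Rightarrow> 'a"
  diamond :: "'a \<Rightarrow> 'a"

definition modal_lattice_iso ::
    "('a \<Rightarrow> 'b) \<Rightarrow> 'a modal_lattice \<Rightarrow> 'b modal_lattice \<Rightarrow> bool" where
  "modal_lattice_iso f L M \<longleftrightarrow>
     bij_betw f (carrier L) (carrier M) \<and>
     (\<forall>a\<in>carrier L. \<forall>b\<in>carrier L. le L a b \<longleftrightarrow> le M (f a) (f b)) \<and>
     (\<forall>S\<subseteq>carrier L. f (Meet L S) = Meet M (f ` S)) \<and>
     (\<forall>S\<subseteq>carrier L. f (Join L S) = Join M (f ` S)) \<and>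
     (\<forall>a\<in>carrier L. f (neg L a) = neg M (f a)) \<and>
     (\<forall>a\<in>carrier L. f (box L a) = box M (f a)) \<and>
     (\<forall>a\<in>carrier L. f (diamond L a) = diamond M (f a))"

definition modal_lattice_isomorphic :: "'a modal_lattice \<Rightarrow> 'b modal_lattice \<Rightarrow> bool" where
  "modal_lattice_isomorphic L M \<longleftrightarrow> (\<exists>f. modal_lattice_iso f L M)"

definition type_lattice ::
    "('a::complete_lattice \<Rightarrow> 'a) \<Rightarrow> ('a \<Rightarrow> 'a) \<Rightarrow> ('a \<Rightarrow> 'a) \<Rightarrow> 'a modal_lattice" where
  "type_lattice n b d =
     \<lparr>carrier = UNIV, le = (\<le>), Meet = Inf, Join = Sup, neg = n, box = b, diamond = d\<rparr>"

text \<open>The intersection with \<open>X\<close> makes the empty meet the top element \<open>X\<close>.\<close>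

definition frame_lattice :: "'x set \<Rightarrow> 'x rel \<Rightarrow> 'x rel \<Rightarrow> 'x rel \<Rightarrow> 'x set modal_lattice" where
  "frame_lattice X lt R Q =
     \<lparr>carrier = closure_fixpoints X lt, le = (\<subseteq>),
      Meet = (\<lambda>S. X \<inter> \<Inter>S), Join = (\<lambda>S. frame_closure X lt (\<Union>S)),
      neg = frame_neg X lt, box = frame_box X R, diamond = frame_diamond X lt Q\<rparr>"

text \<open>
  For every relation, the closure operator laws hold, so the fixpoints form a complete lattice
  with these meets and joins.
\<close>

lemma frame_closure_subset: "frame_closure X lt A \<subseteq> X"
  unfolding frame_closure_def by blast

lemma frame_closure_mono: "A \<subseteq> B \<Longrightarrow> frame_closure X lt A \<subseteq> frame_closure X lt B"
  unfolding frame_closure_def by blast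

lemma frame_closure_extensive: "A \<subseteq> X \<Longrightarrow> A \<subseteq> frame_closure X lt A"
  unfolding frame_closure_def by blast

lemma frame_closure_idem: "frame_closure X lt (frame_closure X lt A) = frame_closure X lt A"
proof
  show "frame_closure X lt (frame_closure X lt A) \<subseteq> frame_closure X lt A"
  proof
    fix x assume x: "x \<in> frame_closure X lt (frame_closure X lt A)"
    have "\<exists>w\<in>X. (y, w) \<in> lt \<and> w \<in> A" if y: "y \<in> X" "(y, x) \<in> lt" for y
    proof -
      obtain z where "(y, z) \<in> lt" "z \<in> frame_closure X lt A"
        using x y unfolding frame_closure_def by auto
      then show ?thesis
        using y unfolding frame_closure_def by simp
    qed
    then show "x \<in> frame_closure X lt A"
      using x unfolding frame_closure_def by simp
  qed
qed (rule frame_closure_extensive[OF frame_closure_subset])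

lemma frame_lattice_Meet:
  assumes S: "S \<subseteq> closure_fixpoints X lt"
  shows "X \<inter> \<Inter>S \<in> closure_fixpoints X lt"
    and "A \<in> S \<Longrightarrow> X \<inter> \<Inter>S \<subseteq> A"
    and "B \<in> closure_fixpoints X lt \<Longrightarrow> \<forall>A\<in>S. B \<subseteq> A \<Longrightarrow> B \<subseteq> X \<inter> \<Inter>S"
proof -
  have "frame_closure X lt (X \<inter> \<Inter>S) \<subseteq> A" if "A \<in> S" for A
  proof -
    have "frame_closure X lt (X \<inter> \<Inter>S) \<subseteq> frame_closure X lt A"
      by (rule frame_closure_mono) (use that in blast)
    also have "frame_closure X lt A = A"
      using S that unfolding closure_fixpoints_def by blast
    finally show ?thesis .
  qed
  then have "frame_closure X lt (X \<inter> \<Inter>S) \<subseteq> X \<inter> \<Inter>S"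
    using frame_closure_subset[of X lt "X \<inter> \<Inter>S"] by simp blast
  moreover have "X \<inter> \<Inter>S \<subseteq> frame_closure X lt (X \<inter> \<Inter>S)"
    by (rule frame_closure_extensive) blast
  ultimately show "X \<inter> \<Inter>S \<in> closure_fixpoints X lt"
    unfolding closure_fixpoints_def by blast
next
  show "B \<subseteq> X \<inter> \<Inter>S" if "B \<in> closure_fixpoints X lt" "\<forall>A\<in>S. B \<subseteq> A"
    using that unfolding closure_fixpoints_def by blast
qed blast

lemma frame_lattice_Join:
  assumes S: "S \<subseteq> closure_fixpoints X lt"
  shows "frame_closure X lt (\<Union>S) \<in> closure_fixpoints X lt"
    and "A \<in> S \<Longrightarrow> A \<subseteq> frame_closure X lt (\<Union>S)"
    and "B \<in> closure_fixpoints X lt \<Longrightarrow> \<forall>A\<in>S. A \<subseteq> B \<Longrightarrow> frame_closure X lt (\<Union>S) \<subseteq> B"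
proof -
  show "frame_closure X lt (\<Union>S) \<in> closure_fixpoints X lt"
    unfolding closure_fixpoints_def
    by (simp add: frame_closure_idem frame_closure_subset)
  have "\<Union>S \<subseteq> X"
    using S unfolding closure_fixpoints_def by blast
  then have "\<Union>S \<subseteq> frame_closure X lt (\<Union>S)"
    by (rule frame_closure_extensive)
  then show "A \<subseteq> frame_closure X lt (\<Union>S)" if "A \<in> S"
    using Union_upper[OF that] by (rule order_trans[rotated])
  show "frame_closure X lt (\<Union>S) \<subseteq> B"
    if "B \<in> closure_fixpoints X lt" "\<forall>A\<in>S. A \<subseteq> B"
  proof -
    have "frame_closure X lt (\<Union>S) \<subseteq> frame_closure X lt B"
      by (rule frame_closure_mono) (use that in blast)
    also have "frame_closure X lt B = B"
      using that unfolding closure_fixpoints_def by blast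
    finally show ?thesis .
  qed
qed

definition completely_multiplicative :: "('a::complete_lattice \<Rightarrow> 'a) \<Rightarrow> bool" where
  "completely_multiplicative b \<longleftrightarrow> (\<forall>S. b (Inf S) = Inf (b ` S))"

definition completely_additive :: "('a::complete_lattice \<Rightarrow> 'a) \<Rightarrow> bool" where
  "completely_additive d \<longleftrightarrow> (\<forall>S. d (Sup S) = Sup (d ` S))"


section \<open>The frame of a complete lattice with operations\<close>

definition pair_points :: "('a::complete_lattice \<Rightarrow> 'a) \<Rightarrow> ('a \<times> 'a) set" where
  "pair_points n = {(a, b). n a \<le> b}"

definition pair_lt :: "('a::complete_lattice \<Rightarrow> 'a) \<Rightarrow> ('a \<times> 'a) rel" where
  "pair_lt n = {(x, y) \<in> pair_points n \<times> pair_points n. \<not> fst y \<le> snd x}"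

definition pair_R :: "('a::complete_lattice \<Rightarrow> 'a) \<Rightarrow> ('a \<Rightarrow> 'a) \<Rightarrow> ('a \<times> 'a) rel" where
  "pair_R n b = {(x, y) \<in> pair_points n \<times> pair_points n. \<forall>a. fst x \<le> b a \<longrightarrow> fst y \<le> a}"

definition pair_Q :: "('a::complete_lattice \<Rightarrow> 'a) \<Rightarrow> ('a \<Rightarrow> 'a) \<Rightarrow> ('a \<times> 'a) rel" where
  "pair_Q n d = {(x, y) \<in> pair_points n \<times> pair_points n. \<forall>a. d a \<le> snd x \<longrightarrow> a \<le> snd y}"

end

theory Submission
  imports Defs
begin

text \<open>
  The isomorphism sends \<open>a\<close> to the set of points whose first coordinate is below \<open>a\<close>. Since
  \<open>\<not>1 = 0\<close>, every pair \<open>(1, c)\<close> is a point, so the relation \<open>\<lhd>\<close> tests a first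
  coordinate against every element \<open>c\<close>; hence the closure of \<open>A\<close> is the image of the join of
  the first coordinates in \<open>A\<close>. Complete multiplicativity and additivity give \<open>\<box>\<close> a left
  adjoint and \<open>\<diamond>\<close> a right adjoint, and these adjoints provide a least first coordinate
  among \<open>R\<close>-successors and a least second coordinate among \<open>Q\<close>-successors.
\<close>

section \<open>Adjoints of the box and the diamond\<close>

lemma completely_multiplicative_adjoint:
  assumes "completely_multiplicative b"
  shows "Inf {c. x \<le> b c} \<le> a \<longleftrightarrow> x \<le> b a"
proof
  assume "Inf {c. x \<le> b c} \<le> a"
  \<comment> \<open>Monotonicity of \<open>b\<close> between these two elements is extracted from
    complete multiplicativity on a two-element set whose meet is its second member.\<close>
  then have "Inf {a, Inf {c. x \<le> b c}} = Inf {c. x \<le> b c}"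
    by (simp add: inf_absorb2)
  then have "Inf (b ` {a, Inf {c. x \<le> b c}}) = b (Inf {c. x \<le> b c})"
    using assms unfolding completely_multiplicative_def by metis
  then have "b (Inf {c. x \<le> b c}) \<le> b a"
    by (metis Inf_lower image_eqI insertI1)
  moreover have "x \<le> b (Inf {c. x \<le> b c})"
    using assms unfolding completely_multiplicative_def by (auto intro: INF_greatest)
  ultimately show "x \<le> b a"
    by (rule order_trans[rotated])
qed (simp add: Inf_lower)

lemma completely_additive_adjoint:
  assumes "completely_additive d"
  shows "a \<le> Sup {c. d c \<le> x} \<longleftrightarrow> d a \<le> x"
proof
  assume "a \<le> Sup {c. d c \<le> x}"
  then have "Sup {a, Sup {c. d c \<le> x}} = Sup {c. d c \<le> x}"
    by (simp add: sup_absorb2)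
  then have "Sup (d ` {a, Sup {c. d c \<le> x}}) = d (Sup {c. d c \<le> x})"
    using assms unfolding completely_additive_def by metis
  then have "d a \<le> d (Sup {c. d c \<le> x})"
    by (metis Sup_upper image_eqI insertI1)
  moreover have "d (Sup {c. d c \<le> x}) \<le> x"
    using assms unfolding completely_additive_def by (auto intro: SUP_least)
  ultimately show "d a \<le> x"
    by (rule order_trans)
qed (simp add: Sup_upper)

section \<open>Points of the frame, extremal successors and closed sets\<close>

definition pair_image :: "('a::complete_lattice \<Rightarrow> 'a) \<Rightarrow> 'a \<Rightarrow> ('a \<times> 'a) set" where
  "pair_image n a = {x \<in> pair_points n. fst x \<le> a}"

lemma mem_pair_image: "x \<in> pair_image n a \<longleftrightarrow> x \<in> pair_points n \<and> fst x \<le> a"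
  by (simp add: pair_image_def)

lemma top_right_mem_pair_points: "(a, top) \<in> pair_points n"
  by (simp add: pair_points_def)

lemma top_left_mem_pair_points: "n top = bot \<Longrightarrow> (top, c) \<in> pair_points n"
  by (simp add: pair_points_def)

lemma mem_pair_lt:
  "(x, y) \<in> pair_lt n \<longleftrightarrow> x \<in> pair_points n \<and> y \<in> pair_points n \<and> \<not> fst y \<le> snd x"
  by (auto simp: pair_lt_def)

text \<open>\<open>pair_R\<close> constrains only the first coordinate of a successor, so that
  coordinate is the left adjoint of \<open>b\<close> at \<open>fst x\<close>; the second is
  \<open>top\<close>, which makes the pair a point whatever the first is.\<close>

lemma pair_R_least_successor:
  assumes "completely_multiplicative b" "x \<in> pair_points n"
  obtains y where "(x, y) \<in> pair_R n b" "\<And>a. fst y \<le> a \<longleftrightarrow> fst x \<le> b a"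
proof
  let ?y = "(Inf {c. fst x \<le> b c}, top)"
  show iff: "fst ?y \<le> a \<longleftrightarrow> fst x \<le> b a" for a
    by (simp add: completely_multiplicative_adjoint[OF assms(1)])
  show "(x, ?y) \<in> pair_R n b"
    using assms(2) top_right_mem_pair_points unfolding pair_R_def
    by (simp add: completely_multiplicative_adjoint[OF assms(1)])
qed

text \<open>Dually, the right adjoint of \<open>d\<close> at \<open>snd x\<close> fills the second
  coordinate, and \<open>n top = bot\<close> lets any second coordinate stand beside
  \<open>top\<close>.\<close>

lemma pair_Q_least_successor:
  assumes "n top = bot" "completely_additive d" "x \<in> pair_points n"
  obtains y where "(x, y) \<in> pair_Q n d" "\<And>a. a \<le> snd y \<longleftrightarrow> d a \<le> snd x"
proof
  let ?y = "(top, Sup {c. d c \<le> snd x})"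
  show iff: "a \<le> snd ?y \<longleftrightarrow> d a \<le> snd x" for a
    by (simp add: completely_additive_adjoint[OF assms(2)])
  show "(x, ?y) \<in> pair_Q n d"
    using assms(3) top_left_mem_pair_points[of n, OF assms(1)] unfolding pair_Q_def
    by (simp add: completely_additive_adjoint[OF assms(2)])
qed

text \<open>Quantifying over \<lhd>-predecessors is the shape shared by \<open>frame_closure\<close>
  and \<open>frame_diamond\<close>, so both later reduce to a test at a single predecessor.\<close>

lemma pair_image_eq_lt:
  assumes "n top = bot"
  shows "pair_image n s =
    {x \<in> pair_points n. \<forall>y\<in>pair_points n. (y, x) \<in> pair_lt n \<longrightarrow> \<not> s \<le> snd y}"
proof (intro set_eqI iffI)
  fix x assume "x \<in> pair_image n s"
  then show "x \<in> {x \<in> pair_points n. \<forall>y\<in>pair_points n. (y, x) \<in> pair_lt n \<longrightarrow> \<not> s \<le> snd y}"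
    by (auto simp: mem_pair_image mem_pair_lt)
next
  fix x
  assume x: "x \<in> {x \<in> pair_points n. \<forall>y\<in>pair_points n. (y, x) \<in> pair_lt n \<longrightarrow> \<not> s \<le> snd y}"
  \<comment> \<open>If \<open>fst x\<close> were not below \<open>s\<close>, this point would
    precede \<open>x\<close>, although \<open>s\<close> lies below its second coordinate.\<close>
  have "(top, s) \<in> pair_points n"
    using assms by (rule top_left_mem_pair_points)
  with x show "x \<in> pair_image n s"
    by (force simp: mem_pair_image mem_pair_lt)
qed

lemma frame_closure_pair:
  assumes "n top = bot" "A \<subseteq> pair_points n"
  shows "frame_closure (pair_points n) (pair_lt n) A = pair_image n (Sup (fst ` A))"
proof -
  \<comment> \<open>No member of \<open>A\<close> lies above \<open>y\<close> exactly when
    \<open>snd y\<close> is an upper bound of the first coordinates of \<open>A\<close>.\<close>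
  have key: "(\<exists>z\<in>pair_points n. (y, z) \<in> pair_lt n \<and> z \<in> A) \<longleftrightarrow> \<not> Sup (fst ` A) \<le> snd y"
    if "y \<in> pair_points n" for y
    using that assms(2) by (auto simp: mem_pair_lt SUP_le_iff)
  then show ?thesis
    unfolding frame_closure_def pair_image_eq_lt[of n, OF assms(1)] by (simp add: key)
qed

text \<open>The supremum is attained at \<open>(a, top)\<close>. Taking suprema of first coordinates
  is thus a left inverse of \<open>pair_image n\<close>, which gives injectivity and order
  reflection.\<close>

lemma Sup_fst_pair_image: "Sup (fst ` pair_image n a) = a"
proof (rule antisym)
  show "Sup (fst ` pair_image n a) \<le> a"
    by (auto simp: mem_pair_image intro: SUP_least)
  have "(a, top) \<in> pair_image n a"
    by (simp add: mem_pair_image top_right_mem_pair_points)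
  then have "a \<in> fst ` pair_image n a"
    by force
  then show "a \<le> Sup (fst ` pair_image n a)"
    by (rule Sup_upper)
qed

lemma pair_image_subset: "pair_image n a \<subseteq> pair_points n"
  by (auto simp: mem_pair_image)

lemma pair_image_le_iff: "pair_image n a \<subseteq> pair_image n a' \<longleftrightarrow> a \<le> a'"
proof
  assume "pair_image n a \<subseteq> pair_image n a'"
  then have "Sup (fst ` pair_image n a) \<le> Sup (fst ` pair_image n a')"
    by (intro Sup_subset_mono image_mono)
  then show "a \<le> a'"
    by (simp only: Sup_fst_pair_image)
qed (auto simp: mem_pair_image)

lemma bij_betw_pair_image:
  assumes "n top = bot"
  shows "bij_betw (pair_image n) UNIV (closure_fixpoints (pair_points n) (pair_lt n))"
proof (rule bij_betw_imageI)
  show "inj (pair_image n)"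
    by (metis Sup_fst_pair_image injI)
  show "range (pair_image n) = closure_fixpoints (pair_points n) (pair_lt n)"
  proof
    show "range (pair_image n) \<subseteq> closure_fixpoints (pair_points n) (pair_lt n)"
      by (simp add: closure_fixpoints_def image_subset_iff pair_image_subset
          frame_closure_pair[of n, OF assms] Sup_fst_pair_image)
    show "closure_fixpoints (pair_points n) (pair_lt n) \<subseteq> range (pair_image n)"
    proof
      fix A assume "A \<in> closure_fixpoints (pair_points n) (pair_lt n)"
      then have "A = pair_image n (Sup (fst ` A))"
        using frame_closure_pair[of n A, OF assms] by (simp add: closure_fixpoints_def)
      then show "A \<in> range (pair_image n)" by (rule range_eqI)
    qed
  qed
qed

section \<open>Preservation of meets, joins and the three operations\<close>

lemma pair_image_Inf: "pair_image n (Inf S) = pair_points n \<inter> \<Inter>(pair_image n ` S)"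
  by (auto simp: mem_pair_image le_Inf_iff)

lemma pair_image_Sup:
  assumes "n top = bot"
  shows "pair_image n (Sup S) =
    frame_closure (pair_points n) (pair_lt n) (\<Union>(pair_image n ` S))"
proof -
  have "Sup (fst ` \<Union>(pair_image n ` S)) = (SUP a\<in>S. Sup (fst ` pair_image n a))"
    by (rule SUP_UNION)
  also have "\<dots> = Sup S"
    by (simp add: Sup_fst_pair_image)
  finally show ?thesis
    using frame_closure_pair[of n "\<Union>(pair_image n ` S)", OF assms] pair_image_subset by auto
qed

lemma pair_image_neg:
  assumes "antimono n"
  shows "pair_image n (n a) = frame_neg (pair_points n) (pair_lt n) (pair_image n a)"
proof -
  have "fst x \<le> n a \<longleftrightarrow> (\<forall>y\<in>pair_points n. fst y \<le> a \<longrightarrow> fst x \<le> snd y)" for x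
  proof
    assume "fst x \<le> n a"
    show "\<forall>y\<in>pair_points n. fst y \<le> a \<longrightarrow> fst x \<le> snd y"
    proof (intro ballI impI)
      fix y assume y: "y \<in> pair_points n" "fst y \<le> a"
      note \<open>fst x \<le> n a\<close>
      also have "n a \<le> n (fst y)" using assms y(2) by (rule antimonoD)
      also have "\<dots> \<le> snd y" using y(1) by (auto simp: pair_points_def)
      finally show "fst x \<le> snd y" .
    qed
  next
    assume "\<forall>y\<in>pair_points n. fst y \<le> a \<longrightarrow> fst x \<le> snd y"
    \<comment> \<open>Among the points with first coordinate \<open>a\<close>, this one has the
      least second coordinate, so it gives the sharpest bound on \<open>fst x\<close>.\<close>
    from this[rule_format, of "(a, n a)"] show "fst x \<le> n a"
      by (simp add: pair_points_def)
  qed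
  then show ?thesis
    unfolding frame_neg_def pair_image_def mem_pair_lt by blast
qed

text \<open>The successor with least first coordinate lies in \<open>pair_image n a\<close> exactly
  when \<open>fst x \<le> b a\<close>, so it alone decides the box.\<close>

lemma pair_image_box:
  assumes "completely_multiplicative b"
  shows "pair_image n (b a) = frame_box (pair_points n) (pair_R n b) (pair_image n a)"
proof -
  have "fst x \<le> b a \<longleftrightarrow> (\<forall>y\<in>pair_points n. (x, y) \<in> pair_R n b \<longrightarrow> fst y \<le> a)"
    if x: "x \<in> pair_points n" for x
  proof
    obtain y where y: "(x, y) \<in> pair_R n b" "\<And>a. fst y \<le> a \<longleftrightarrow> fst x \<le> b a"
      using pair_R_least_successor[OF assms x] by blast
    assume "\<forall>y\<in>pair_points n. (x, y) \<in> pair_R n b \<longrightarrow> fst y \<le> a"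
    with y show "fst x \<le> b a" by (auto simp: pair_R_def)
  qed (auto simp: pair_R_def)
  then show ?thesis
    unfolding frame_box_def pair_image_def by auto
qed

lemma pair_image_diamond:
  assumes "n top = bot" "completely_additive d"
  shows "pair_image n (d a) =
    frame_diamond (pair_points n) (pair_lt n) (pair_Q n d) (pair_image n a)"
proof -
  \<comment> \<open>\<open>(a, top)\<close> has the largest first coordinate in
    \<open>pair_image n a\<close>, so it lies above \<open>y'\<close> as soon as any point of that
    set does.\<close>
  have above: "(\<exists>y\<in>pair_points n. (y', y) \<in> pair_lt n \<and> y \<in> pair_image n a) \<longleftrightarrow> \<not> a \<le> snd y'"
    if "y' \<in> pair_points n" for y'
  proof
    assume "\<not> a \<le> snd y'"
    then show "\<exists>y\<in>pair_points n. (y', y) \<in> pair_lt n \<and> y \<in> pair_image n a"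
      using that top_right_mem_pair_points[of a n]
      by (intro bexI[of _ "(a, top)"]) (auto simp: mem_pair_lt mem_pair_image)
  qed (auto simp: mem_pair_lt mem_pair_image)
  \<comment> \<open>If any successor violates \<open>a \<le> snd y'\<close>, then so does the one
    with least second coordinate, and it does so exactly when \<open>d a \<le> snd x'\<close>
    fails.\<close>
  have key: "(\<exists>y'\<in>pair_points n. (x', y') \<in> pair_Q n d \<and> \<not> a \<le> snd y') \<longleftrightarrow> \<not> d a \<le> snd x'"
    if x': "x' \<in> pair_points n" for x'
  proof
    obtain y' where y': "(x', y') \<in> pair_Q n d" "a \<le> snd y' \<longleftrightarrow> d a \<le> snd x'"
      using pair_Q_least_successor[of n, OF assms x'] by blast
    assume "\<not> d a \<le> snd x'"
    with y' show "\<exists>y'\<in>pair_points n. (x', y') \<in> pair_Q n d \<and> \<not> a \<le> snd y'"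
      by (intro bexI[of _ y']) (auto simp: pair_Q_def)
  qed (auto simp: pair_Q_def)
  show ?thesis
    unfolding frame_diamond_def pair_image_eq_lt[of n "d a", OF assms(1)]
    by (simp add: above key cong: bex_cong)
qed

section \<open>The two frame conditions\<close>

lemma additive_modal_frame_pair:
  assumes "n top = bot" "completely_multiplicative b" "completely_additive d"
  shows "additive_modal_frame (pair_points n) (pair_lt n) (pair_R n b) (pair_Q n d)"
proof
  show "pair_points n \<noteq> {}"
    using top_right_mem_pair_points by blast
  show "pair_lt n \<subseteq> pair_points n \<times> pair_points n"
    "pair_R n b \<subseteq> pair_points n \<times> pair_points n"
    "pair_Q n d \<subseteq> pair_points n \<times> pair_points n"
    by (auto simp: pair_lt_def pair_R_def pair_Q_def)
  show "\<forall>x\<in>pair_points n. \<forall>y\<in>pair_points n. \<forall>z\<in>pair_points n.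
      (x, y) \<in> pair_R n b \<and> (z, y) \<in> pair_lt n \<longrightarrow>
      (\<exists>x'\<in>pair_points n. (x', x) \<in> pair_lt n \<and> (\<forall>x''\<in>pair_points n. (x', x'') \<in> pair_lt n \<longrightarrow>
        (\<exists>y''\<in>pair_points n. (x'', y'') \<in> pair_R n b \<and> (z, y'') \<in> pair_lt n)))"
  proof (intro ballI impI, elim conjE)
    fix x y z
    assume mem: "x \<in> pair_points n" "y \<in> pair_points n" "z \<in> pair_points n"
      and R: "(x, y) \<in> pair_R n b" and lt: "(z, y) \<in> pair_lt n"
    \<comment> \<open>Chosen so that \<open>?x'\<close> precedes a point \<open>w\<close> iff
      \<open>fst w \<le> b (snd z)\<close> fails; by adjointness this says that \<open>z\<close>
      precedes the least \<open>R\<close>-successor of \<open>w\<close>.\<close>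
    let ?x' = "(top, b (snd z))"
    have x': "?x' \<in> pair_points n"
      using assms(1) by (rule top_left_mem_pair_points)
    have "(?x', x) \<in> pair_lt n"
      using mem x' R lt by (auto simp: pair_R_def mem_pair_lt)
    moreover have "\<exists>y''\<in>pair_points n. (x'', y'') \<in> pair_R n b \<and> (z, y'') \<in> pair_lt n"
      if x'': "x'' \<in> pair_points n" "(?x', x'') \<in> pair_lt n" for x''
    proof -
      obtain y'' where y'': "(x'', y'') \<in> pair_R n b" "\<And>a. fst y'' \<le> a \<longleftrightarrow> fst x'' \<le> b a"
        using pair_R_least_successor[OF assms(2) x''(1)] by blast
      then have "y'' \<in> pair_points n" by (simp add: pair_R_def)
      with y'' x'' mem show ?thesis by (auto simp: mem_pair_lt intro!: bexI[of _ y''])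
    qed
    ultimately show "\<exists>x'\<in>pair_points n. (x', x) \<in> pair_lt n \<and>
        (\<forall>x''\<in>pair_points n. (x', x'') \<in> pair_lt n \<longrightarrow>
        (\<exists>y''\<in>pair_points n. (x'', y'') \<in> pair_R n b \<and> (z, y'') \<in> pair_lt n))"
      using x' by blast
  qed
  show "\<forall>x\<in>pair_points n. \<forall>y\<in>pair_points n. \<forall>z\<in>pair_points n.
      (x, y) \<in> pair_Q n d \<and> (y, z) \<in> pair_lt n \<longrightarrow>
      (\<exists>x'\<in>pair_points n. (x, x') \<in> pair_lt n \<and> (\<forall>x''\<in>pair_points n. (x'', x') \<in> pair_lt n \<longrightarrow>
        (\<exists>y''\<in>pair_points n. (x'', y'') \<in> pair_Q n d \<and> (y'', z) \<in> pair_lt n)))"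
  proof (intro ballI impI, elim conjE)
    fix x y z
    assume mem: "x \<in> pair_points n" "y \<in> pair_points n" "z \<in> pair_points n"
      and Q: "(x, y) \<in> pair_Q n d" and lt: "(y, z) \<in> pair_lt n"
    \<comment> \<open>Chosen so that a point \<open>w\<close> precedes \<open>?x'\<close> iff
      \<open>d (fst z) \<le> snd w\<close> fails; by adjointness this says that the least
      \<open>Q\<close>-successor of \<open>w\<close> precedes \<open>z\<close>.\<close>
    let ?x' = "(d (fst z), top)"
    have x': "?x' \<in> pair_points n"
      by (rule top_right_mem_pair_points)
    have "(x, ?x') \<in> pair_lt n"
      using mem x' Q lt by (auto simp: pair_Q_def mem_pair_lt)
    moreover have "\<exists>y''\<in>pair_points n. (x'', y'') \<in> pair_Q n d \<and> (y'', z) \<in> pair_lt n"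
      if x'': "x'' \<in> pair_points n" "(x'', ?x') \<in> pair_lt n" for x''
    proof -
      obtain y'' where y'': "(x'', y'') \<in> pair_Q n d" "\<And>a. a \<le> snd y'' \<longleftrightarrow> d a \<le> snd x''"
        using pair_Q_least_successor[of n, OF assms(1,3) x''(1)] by blast
      then have "y'' \<in> pair_points n" by (simp add: pair_Q_def)
      with y'' x'' mem show ?thesis by (auto simp: mem_pair_lt intro!: bexI[of _ y''])
    qed
    ultimately show "\<exists>x'\<in>pair_points n. (x, x') \<in> pair_lt n \<and>
        (\<forall>x''\<in>pair_points n. (x'', x') \<in> pair_lt n \<longrightarrow>
        (\<exists>y''\<in>pair_points n. (x'', y'') \<in> pair_Q n d \<and> (y'', z) \<in> pair_lt n))"
      using x' by blast
  qed
qed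

theorem theorem3p7:
  fixes n b d :: "'a::complete_lattice \<Rightarrow> 'a"
  assumes "antimono n"
    and "n top = bot"
    and "completely_multiplicative b"
    and "completely_additive d"
  shows "additive_modal_frame (pair_points n) (pair_lt n) (pair_R n b) (pair_Q n d) \<and>
    modal_lattice_isomorphic (type_lattice n b d)
      (frame_lattice (pair_points n) (pair_lt n) (pair_R n b) (pair_Q n d))"
proof
  show "additive_modal_frame (pair_points n) (pair_lt n) (pair_R n b) (pair_Q n d)"
    using assms(2-4) by (rule additive_modal_frame_pair)
  have "modal_lattice_iso (pair_image n) (type_lattice n b d)
      (frame_lattice (pair_points n) (pair_lt n) (pair_R n b) (pair_Q n d))"
    unfolding modal_lattice_iso_def type_lattice_def frame_lattice_def modal_lattice.simps
    by (intro conjI ballI allI impI bij_betw_pair_image[of n, OF assms(2)]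
        pair_image_le_iff[symmetric] pair_image_Inf pair_image_Sup[of n, OF assms(2)]
        pair_image_neg[OF assms(1)] pair_image_box[OF assms(3)]
        pair_image_diamond[of n, OF assms(2,4)])
  then show "modal_lattice_isomorphic (type_lattice n b d)
      (frame_lattice (pair_points n) (pair_lt n) (pair_R n b) (pair_Q n d))"
    unfolding modal_lattice_isomorphic_def by blast
qed

end
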